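(* Let $\mathcal{C}$ be a $C^4$ embedded convex curve, let $p_0\in\mathcal{C}$, and let $c=c_{\mathcal{C},p_0}\colon I_{\mathcal{C},p_0}\to\mathcal{C}$ be the standard parameterization of $\mathcal{C}$ at $p_0$. Assume $(-L,L)\subseteq I_{\mathcal{C},p_0}$ for some $L>0$. Also assume that for some constants $k_0$ and $k_1$ the affine curvature of $\mathcal{C}$ satisfies $k_0\le\kappa(s)\le k_1$ for $-L\le s\le L$, $s\in I_{\mathcal{C},p_0}$, and that $k_1\le(\pi/(2L))^2$. Let $\xi,\eta$ be the affine adapted coordinates to $\mathcal{C}$ at $p_0$ and let $x(s)=\xi(c(s))$, $y(s)=\eta(c(s))$. Then $(-L,L)$ is contained in the graphing parameter set of $\mathcal{C}$ about $p_0$, and the inequalities $$\bar x_{k_1}(|s|)\le|x(s)|\le\bar x_{k_0}(|s|),\tag{1}$$ $$\bar y_{k_1}(s)\le y(s)\le\bar y_{k_0}(s)\tag{2}$$ hold for $s\in(-L,L)$. Letting $R:=\bar x_{k_1}(L)$, the graphing interval of $\mathcal{C}$ at $p_0$ contains $(-R,R)$. If $s_1\in(-L,L)$ with $s_1\ne0$ and equality holds at $s=s_1$ in either of the lower bounds of (1) or (2), then the restriction of $c$ to the interval of points between $0$ and $s_1$ is a curve of constant affine curvature $k_1$. Likewise, if equality holds at $s=s_1$ in either of the upper bounds of (1) or (2), then the restriction of $c$ to the interval of points between $0$ and $s_1$ is a curve of constant affine curvature $k_0$.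
   Context: For $v,w\in\mathbb{R}^2$ put $v\wedge w=v_1w_2-v_2w_1$. A $C^3$ curve $c$ has affine unit speed if $c'\wedge c''\equiv1$; its affine curvature $\kappa$ is defined by $c'''=-\kappa c'$. A convex curve is an embedded connected curve contained in the boundary of its convex hull (assumed to admit an affine unit speed parameterization). The standard parameterization of $\mathcal{C}$ at $p_0$ is the affine unit speed parameterization $c_{\mathcal{C},p_0}\colon I_{\mathcal{C},p_0}\to\mathcal{C}$ on an interval $I_{\mathcal{C},p_0}\ni0$ with $c_{\mathcal{C},p_0}(0)=p_0$ that parameterizes all of $\mathcal{C}$; $\kappa(s)$ is the affine curvature at $c(s)$. The affine adapted coordinates $\xi,\eta$ to $\mathcal{C}$ at $p_0$ are the coordinates on $\mathbb{R}^2$ defined by $p=p_0+\xi(p)\,c_{\mathcal{C},p_0}'(0)+\eta(p)\,c_{\mathcal{C},p_0}''(0)$. The graphing parameter set $I^*_{\mathcal{C},p_0}$ is the maximal subinterval of $I_{\mathcal{C},p_0}$ containing $0$ such that the image of the restriction of $c_{\mathcal{C},p_0}$ to it is a graph $\eta=f(\xi)$ in the adapted coordinates; the graphing interval is $\{\xi(c(s)):s\in I^*_{\mathcal{C},p_0}\}$. For $k\in\mathbb{R}$: $\bar x_k(s)=\sin(\sqrt k\,s)/\sqrt k$ if $k>0$, $\bar x_0(s)=s$, $\bar x_k(s)=\sinh(\sqrt{|k|}\,s)/\sqrt{|k|}$ if $k<0$; and $\bar y_k(s)=(1-\cos(\sqrt k\,s))/k$ if $k>0$, $\bar y_0(s)=s^2/2$,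 $\bar y_k(s)=(1-\cosh(\sqrt{|k|}\,s))/k$ if $k<0$. *)

theory Defs
  imports "HOL-Analysis.Analysis"
begin

definition wedge :: "real^2 \<Rightarrow> real^2 \<Rightarrow> real" where
  "wedge v w = v$1 * w$2 - v$2 * w$1"

text \<open>Derivatives are taken within the parameter interval, so they are one-sided at those
  endpoints that belong to it.\<close>

definition deriv_on :: "real set \<Rightarrow> nat \<Rightarrow> (real \<Rightarrow> 'a::real_normed_vector) \<Rightarrow> real \<Rightarrow> 'a" where
  "deriv_on I n c = ((\<lambda>f t. vector_derivative f (at t within I)) ^^ n) c"

definition C_k_on :: "nat \<Rightarrow> (real \<Rightarrow> 'a::real_normed_vector) \<Rightarrow> real set \<Rightarrow> bool" where
  "C_k_on k c I \<longleftrightarrow>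
     (\<forall>j<k. \<forall>t\<in>I. deriv_on I j c differentiable (at t within I)) \<and>
     (\<forall>j\<le>k. continuous_on I (deriv_on I j c))"

text \<open>A one-dimensional embedded submanifold of class \<open>C\<^sup>k\<close>, described by local regular
  parameterizations that are homeomorphisms onto relatively open pieces of \<open>C\<close>. The parameter
  intervals may be open, half-open or closed, so \<open>C\<close> may have endpoints; it may also be a closed
  curve.\<close>

definition embedded_curve :: "nat \<Rightarrow> (real^2) set \<Rightarrow> bool" where
  "embedded_curve k C \<longleftrightarrow>
     (\<forall>p\<in>C. \<exists>U J \<gamma> g. open U \<and> p \<in> U \<and> is_interval J \<and> interior J \<noteq> {} \<and>
        C_k_on k \<gamma> J \<and> (\<forall>t\<in>J. deriv_on J 1 \<gamma> t \<noteq> 0) \<and> homeomorphism J (C \<inter> U) \<gamma> g)"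

definition convex_curve :: "nat \<Rightarrow> (real^2) set \<Rightarrow> bool" where
  "convex_curve k C \<longleftrightarrow> embedded_curve k C \<and> connected C \<and> C \<subseteq> frontier (convex hull C)"

definition affine_unit_speed :: "real set \<Rightarrow> (real \<Rightarrow> real^2) \<Rightarrow> bool" where
  "affine_unit_speed I c \<longleftrightarrow>
     C_k_on 3 c I \<and> (\<forall>t\<in>I. wedge (deriv_on I 1 c t) (deriv_on I 2 c t) = 1)"

definition affine_curvature :: "real set \<Rightarrow> (real \<Rightarrow> real^2) \<Rightarrow> real \<Rightarrow> real" where
  "affine_curvature I c s = (THE \<kappa>. deriv_on I 3 c s = - \<kappa> *\<^sub>R deriv_on I 1 c s)"

definition constant_affine_curvature :: "real set \<Rightarrow> (real \<Rightarrow> real^2) \<Rightarrow> real \<Rightarrow> bool" where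
  "constant_affine_curvature I c k \<longleftrightarrow>
     affine_unit_speed I c \<and> (\<forall>s\<in>I. affine_curvature I c s = k)"

text \<open>If \<open>C\<close> is a closed curve, \<open>c\<close> may run around it more than once (for instance, \<open>I\<close> may be
  the whole line and \<open>c\<close> periodic).\<close>

definition standard_parameterization ::
    "(real^2) set \<Rightarrow> real^2 \<Rightarrow> real set \<Rightarrow> (real \<Rightarrow> real^2) \<Rightarrow> bool" where
  "standard_parameterization C p\<^sub>0 I c \<longleftrightarrow>
     is_interval I \<and> interior I \<noteq> {} \<and> 0 \<in> I \<and> affine_unit_speed I c \<and> c 0 = p\<^sub>0 \<and> c ` I = C"

definition affine_adapted_coordinates ::
    "real^2 \<Rightarrow> real set \<Rightarrow> (real \<Rightarrow> real^2) \<Rightarrow> (real^2 \<Rightarrow> real) \<Rightarrow> (real^2 \<Rightarrow> real) \<Rightarrow> bool" where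
  "affine_adapted_coordinates p\<^sub>0 I c \<xi> \<eta> \<longleftrightarrow>
     (\<forall>p. p = p\<^sub>0 + \<xi> p *\<^sub>R deriv_on I 1 c 0 + \<eta> p *\<^sub>R deriv_on I 2 c 0)"

definition is_graph_in :: "(real^2 \<Rightarrow> real) \<Rightarrow> (real^2 \<Rightarrow> real) \<Rightarrow> (real^2) set \<Rightarrow> bool" where
  "is_graph_in \<xi> \<eta> S \<longleftrightarrow> (\<exists>D f. S = {p. \<xi> p \<in> D \<and> \<eta> p = f (\<xi> p)})"

text \<open>\<open>GREATEST\<close> is with respect to inclusion. The greatest such \<open>J\<close> exists for every
  affine unit speed \<open>c\<close>: on each admissible \<open>J\<close> the function \<open>\<xi> \<circ> c\<close> is continuous and
  locally injective with positive derivative at \<open>0\<close>, hence strictly increasing, so unions of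
  admissible intervals are admissible.\<close>

definition graphing_parameter_set ::
    "real set \<Rightarrow> (real \<Rightarrow> real^2) \<Rightarrow> (real^2 \<Rightarrow> real) \<Rightarrow> (real^2 \<Rightarrow> real) \<Rightarrow> real set" where
  "graphing_parameter_set I c \<xi> \<eta> =
     (GREATEST J. J \<subseteq> I \<and> is_interval J \<and> 0 \<in> J \<and> is_graph_in \<xi> \<eta> (c ` J))"

definition graphing_interval ::
    "real set \<Rightarrow> (real \<Rightarrow> real^2) \<Rightarrow> (real^2 \<Rightarrow> real) \<Rightarrow> (real^2 \<Rightarrow> real) \<Rightarrow> real set" where
  "graphing_interval I c \<xi> \<eta> = (\<lambda>s. \<xi> (c s)) ` graphing_parameter_set I c \<xi> \<eta>"

definition xbar :: "real \<Rightarrow> real \<Rightarrow> real" where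
  "xbar k s = (if k > 0 then sin (sqrt k * s) / sqrt k
               else if k = 0 then s
               else sinh (sqrt \<bar>k\<bar> * s) / sqrt \<bar>k\<bar>)"

definition ybar :: "real \<Rightarrow> real \<Rightarrow> real" where
  "ybar k s = (if k > 0 then (1 - cos (sqrt k * s)) / k
               else if k = 0 then s\<^sup>2 / 2
               else (1 - cosh (sqrt \<bar>k\<bar> * s)) / k)"

end

theory Submission
  imports Defs
begin

text \<open>
  In adapted coordinates the curve becomes a pair of functions \<open>x, y\<close> whose derivatives satisfy
  the same scalar equation. Indeed \<open>c''' = - \<kappa> c'\<close>, so \<open>u = x'\<close> and \<open>v = y'\<close> both solve the
  Jacobi equation \<open>f'' + \<kappa> f = 0\<close>, with initial data \<open>u 0 = 1\<close>, \<open>u' 0 = 0\<close> and \<open>v 0 = 0\<close>,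
  \<open>v' 0 = 1\<close>. For constant \<open>\<kappa> = k\<close> the solutions are the derivatives of \<open>xbar k\<close> and \<open>ybar k\<close>.
  The estimates are therefore Sturm comparison followed by an integration: raising the
  coefficient lowers the solution as long as it is positive. The condition on \<open>k\<^sub>1\<close> makes the model
  solutions for \<open>k\<^sub>1\<close> positive on \<open>(0, L)\<close>, and comparison from below passes this positivity on
  to \<open>u\<close> and \<open>v\<close>, which is what the comparison from above starts from
  (\<open>sturm_primitive_comparison\<close>, \<open>model_bounds\<close>). Negative parameters are reached by reflecting
  \<open>s\<close> to \<open>- s\<close> (\<open>jacobi_on_both_sides\<close>).

  If equality holds at \<open>s\<^sub>1\<close>, two functions whose difference is monotone agree at \<open>0\<close> and at
  \<open>s\<^sub>1\<close>, hence in between, and so do their third derivatives; this identifies \<open>\<kappa>\<close> strictly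
  between \<open>0\<close> and \<open>s\<^sub>1\<close>, and continuity of \<open>\<kappa>\<close> does the rest.

  Since \<open>u > 0\<close>, the abscissa \<open>x\<close> increases on \<open>(-L, L)\<close>. The image of an interval is a graph
  exactly if \<open>\<xi>\<close> is injective on that image, and an argument with locally injective functions shows
  that the intervals through \<open>0\<close> with this property are those on which \<open>x\<close> increases. They have a
  greatest member, and it contains \<open>(-L, L)\<close> (\<open>subset_graphing_parameter_set\<close>). The graphing
  interval then contains \<open>(-R, R)\<close> by the lower bound for \<open>\<bar>x\<bar>\<close> and the intermediate value theorem.
\<close>

section \<open>Comparison for the Jacobi equation\<close>

text \<open>In adapted coordinates the velocity of an affine unit speed curve solves the Jacobi equation
  componentwise. The predicate keeps a primitive \<open>F\<close> of the solution \<open>f\<close> along, because the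
  coordinates of the curve itself are the functions to be estimated.\<close>

definition jacobi_on ::
    "real \<Rightarrow> (real \<Rightarrow> real) \<Rightarrow> (real \<Rightarrow> real) \<Rightarrow> (real \<Rightarrow> real) \<Rightarrow> (real \<Rightarrow> real) \<Rightarrow> bool" where
  "jacobi_on L p F f f' \<longleftrightarrow>
     (\<forall>t\<in>{0..<L}. (F has_real_derivative f t) (at t) \<and> (f has_real_derivative f' t) (at t) \<and>
        (f' has_real_derivative - p t * f t) (at t))"

lemma jacobi_onD:
  assumes "jacobi_on L p F f f'" "0 \<le> t" "t < L"
  shows "(F has_real_derivative f t) (at t)"
    and "(f has_real_derivative f' t) (at t)"
    and "(f' has_real_derivative - p t * f t) (at t)"
  using assms by (auto simp: jacobi_on_def)

lemma positive_near_0: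
  fixes f :: "real \<Rightarrow> real"
  assumes deriv: "(f has_real_derivative m) (at 0)" and init: "0 < f 0 \<or> f 0 = 0 \<and> 0 < m"
  shows "\<exists>d>0. \<forall>t. 0 < t \<and> t < d \<longrightarrow> 0 < f t"
proof (cases "0 < f 0")
  case True
  have "isCont f 0" using deriv by (rule DERIV_isCont)
  then have "(f \<longlongrightarrow> f 0) (at 0)" by (simp add: isCont_def)
  with True have "eventually (\<lambda>t. 0 < f t) (at 0)" by (simp add: order_tendstoD)
  then show ?thesis unfolding eventually_at by (force simp: dist_real_def)
next
  case False
  with init have "f 0 = 0" "0 < m" by auto
  with DERIV_pos_inc_right[OF deriv] show ?thesis by auto
qed

text \<open>The derivative of the Wronskian \<open>g' f - g f'\<close> is \<open>(p - q) f g\<close>. As long as both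
  solutions are positive the Wronskian is therefore nonnegative, and it is the numerator of the
  derivative of \<open>g / f\<close>.\<close>

lemma sturm_ratio_mono:
  assumes F: "jacobi_on L p F f f'" and G: "jacobi_on L q G g g'"
    and pq: "\<And>t. 0 \<le> t \<Longrightarrow> t < L \<Longrightarrow> q t \<le> p t"
    and f_pos: "\<And>t. 0 < t \<Longrightarrow> t < L \<Longrightarrow> 0 < f t"
    and init: "f 0 = g 0" "f' 0 = g' 0"
    and "T < L" and g_nonneg: "\<And>t. 0 < t \<Longrightarrow> t \<le> T \<Longrightarrow> 0 \<le> g t"
    and ab: "0 < a" "a \<le> b" "b \<le> T"
  shows "g a / f a \<le> g b / f b"
proof -
  define w where "w t = g' t * f t - g t * f' t" for t
  have w': "(w has_real_derivative (p t - q t) * (f t * g t)) (at t)" if "0 \<le> t" "t < L" for t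
    unfolding w_def
    by (rule derivative_eq_intros jacobi_onD[OF F that] jacobi_onD[OF G that] refl)+
      (simp add: algebra_simps)
  have fg: "0 \<le> f t * g t" if "0 \<le> t" "t \<le> T" for t
  proof (cases "t = 0")
    case False
    with that f_pos[of t] g_nonneg[of t] \<open>T < L\<close> show ?thesis by simp
  qed (simp add: init)
  have w_nonneg: "0 \<le> w t" if "0 \<le> t" "t \<le> T" for t
  proof -
    have "w 0 \<le> w t"
    proof (rule DERIV_nonneg_imp_nondecreasing[OF that(1)])
      fix s assume "0 \<le> s" "s \<le> t"
      with that \<open>T < L\<close> w'[of s] fg[of s] pq[of s]
      show "\<exists>y. (w has_real_derivative y) (at s) \<and> 0 \<le> y" by force
    qed
    then show ?thesis by (simp add: w_def init)
  qed
  show ?thesis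
  proof (rule DERIV_nonneg_imp_nondecreasing[OF ab(2)])
    fix s assume s: "a \<le> s" "s \<le> b"
    with ab \<open>T < L\<close> have s': "0 \<le> s" "s < L" "0 < f s" "0 \<le> w s"
      using f_pos[of s] w_nonneg[of s] by auto
    have "((\<lambda>t. g t / f t) has_real_derivative w s / (f s * f s)) (at s)"
      using DERIV_divide[OF jacobi_onD(2)[OF G s'(1,2)] jacobi_onD(2)[OF F s'(1,2)]] s'(3)
      by (simp add: w_def)
    with s' show "\<exists>y. ((\<lambda>t. g t / f t) has_real_derivative y) (at s) \<and> 0 \<le> y"
      by (meson divide_nonneg_pos mult_pos_pos)
  qed
qed

text \<open>The initial data make \<open>g\<close> positive near \<open>0\<close>. At a first zero of \<open>g\<close> the ratio \<open>g / f\<close>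
  would vanish, although up to there it does not decrease from a positive value.\<close>

lemma sturm_positive:
  assumes F: "jacobi_on L p F f f'" and G: "jacobi_on L q G g g'"
    and pq: "\<And>t. 0 \<le> t \<Longrightarrow> t < L \<Longrightarrow> q t \<le> p t"
    and f_pos: "\<And>t. 0 < t \<Longrightarrow> t < L \<Longrightarrow> 0 < f t"
    and init: "f 0 = g 0" "f' 0 = g' 0"
    and pos0: "0 < g 0 \<or> g 0 = 0 \<and> 0 < g' 0"
    and s: "0 < s" "s < L"
  shows "0 < g s"
proof (rule ccontr)
  assume "\<not> 0 < g s"
  have "(g has_real_derivative g' 0) (at 0)" using jacobi_onD(2)[OF G] s by simp
  from positive_near_0[OF this pos0] obtain d
    where d: "d > 0" "\<And>t. 0 < t \<Longrightarrow> t < d \<Longrightarrow> 0 < g t" by auto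
  define e where "e = min (d / 2) s"
  have e: "0 < e" "e < d" "e \<le> s" using d s by (auto simp: e_def)
  have g_cont: "continuous_on {e..s} g"
    using jacobi_onD(2)[OF G] e s
    by (intro continuous_at_imp_continuous_on ballI DERIV_isCont[OF jacobi_onD(2)[OF G]]) auto
  define Z where "Z = {t \<in> {e..s}. g t \<le> 0}"
  have "compact Z"
  proof -
    have "closed Z" unfolding Z_def
      by (intro continuous_on_closed_Collect_le g_cont continuous_on_const closed_atLeastAtMost)
    moreover have "bounded Z" by (rule bounded_subset[of "{e..s}"]) (auto simp: Z_def)
    ultimately show ?thesis by (simp add: compact_eq_bounded_closed)
  qed
  moreover have "s \<in> Z" using \<open>\<not> 0 < g s\<close> e by (simp add: Z_def)
  ultimately obtain T where T: "T \<in> Z" "\<And>t. t \<in> Z \<Longrightarrow> T \<le> t"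
    using compact_attains_inf[of Z] by blast
  have eT: "e \<le> T" "T \<le> s" "g T \<le> 0" using T(1) by (auto simp: Z_def)
  have "g T = 0"
  proof -
    have "0 \<le> g e" using d(2)[OF e(1,2)] by simp
    moreover have "continuous_on {e..T} g" using eT by (intro continuous_on_subset[OF g_cont]) auto
    ultimately obtain z where "e \<le> z" "z \<le> T" "g z = 0"
      using IVT2'[of g T 0 e] eT by blast
    with T(2)[of z] eT show ?thesis by (auto simp: Z_def)
  qed
  have "0 \<le> g t" if "0 < t" "t \<le> T" for t
  proof (cases "t < e")
    case True
    with d e that show ?thesis by (simp add: less_imp_le)
  next
    case False
    with T(2)[of t] that eT \<open>g T = 0\<close> show ?thesis by (force simp: Z_def)
  qed
  from sturm_ratio_mono[OF F G pq f_pos init _ this, where T = T and a = e and b = T] eT e s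
  have "g e / f e \<le> g T / f T" by auto
  moreover have "0 < g e / f e" using d e s f_pos by auto
  ultimately show False by (simp add: \<open>g T = 0\<close>)
qed

text \<open>Since \<open>g / f\<close> is nondecreasing, \<open>h t = f s * g t - g s * f t\<close> is nonpositive on \<open>(0, s]\<close>.
  At \<open>0\<close> the leading one of \<open>h 0\<close> and \<open>h' 0\<close> is \<open>f s - g s\<close> times the common positive initial
  datum. Arguing with \<open>h\<close> instead of the limit of \<open>g / f\<close> at \<open>0\<close> treats the initial conditions
  \<open>g 0 > 0\<close> and \<open>g 0 = 0\<close> alike.\<close>

lemma sturm_le:
  assumes F: "jacobi_on L p F f f'" and G: "jacobi_on L q G g g'"
    and pq: "\<And>t. 0 \<le> t \<Longrightarrow> t < L \<Longrightarrow> q t \<le> p t"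
    and f_pos: "\<And>t. 0 < t \<Longrightarrow> t < L \<Longrightarrow> 0 < f t"
    and init: "f 0 = g 0" "f' 0 = g' 0"
    and pos0: "0 < g 0 \<or> g 0 = 0 \<and> 0 < g' 0"
    and s: "0 \<le> s" "s < L"
  shows "f s \<le> g s"
proof (cases "s = 0")
  case False
  with s have s0: "0 < s" by simp
  note g_pos = sturm_positive[OF F G pq f_pos init pos0]
  show ?thesis
  proof (rule ccontr)
    assume "\<not> f s \<le> g s"
    define h where "h t = f s * g t - g s * f t" for t
    have h': "(h has_real_derivative (f s - g s) * g' 0) (at 0)"
      unfolding h_def using s s0 jacobi_onD(2)[OF F, of 0] jacobi_onD(2)[OF G, of 0] init
      by (auto intro!: derivative_eq_intros simp: algebra_simps)
    have "0 < h 0 \<or> h 0 = 0 \<and> 0 < (f s - g s) * g' 0"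
      using pos0 \<open>\<not> f s \<le> g s\<close> by (auto simp: h_def init algebra_simps)
    from positive_near_0[OF h' this] obtain d
      where d: "d > 0" "\<And>t. 0 < t \<Longrightarrow> t < d \<Longrightarrow> 0 < h t" by auto
    define t where "t = min (d / 2) s"
    have t: "0 < t" "t < d" "t \<le> s" using d s0 by (auto simp: t_def)
    have "g t / f t \<le> g s / f s"
      using sturm_ratio_mono[OF F G pq f_pos init s(2), of t s] g_pos t s
      by (simp add: less_imp_le)
    then have "h t \<le> 0"
      using f_pos[of t] f_pos[of s] t s s0 by (simp add: h_def field_simps)
    with d t show False by force
  qed
qed (simp add: init)

lemma primitives_le:
  fixes F G :: "real \<Rightarrow> real"
  assumes "\<And>t. 0 \<le> t \<Longrightarrow> t < L \<Longrightarrow> (F has_real_derivative f t) (at t)"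
    and "\<And>t. 0 \<le> t \<Longrightarrow> t < L \<Longrightarrow> (G has_real_derivative g t) (at t)"
    and "\<And>t. 0 \<le> t \<Longrightarrow> t < L \<Longrightarrow> f t \<le> g t"
    and "0 \<le> a" "a \<le> b" "b < L"
  shows "G a - F a \<le> G b - F b"
proof (rule DERIV_nonneg_imp_nondecreasing[OF \<open>a \<le> b\<close>])
  fix t assume "a \<le> t" "t \<le> b"
  with assms DERIV_diff[of G "g t" t UNIV F "f t"]
  show "\<exists>y. ((\<lambda>t. G t - F t) has_real_derivative y) (at t) \<and> 0 \<le> y" by force
qed

lemma derivatives_eq_on_open_interval:
  fixes F G :: "real \<Rightarrow> real"
  assumes "\<And>t. a < t \<Longrightarrow> t < b \<Longrightarrow> F t = G t"
    and "(F has_real_derivative m) (at t)" "(G has_real_derivative n) (at t)" "a < t" "t < b"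
  shows "m = n"
  using has_field_derivative_transform_within_open[OF assms(2), of "{a<..<b}" G] assms
  by (auto intro: DERIV_unique)

text \<open>In the equality case \<open>G - F\<close> is nondecreasing and vanishes at both ends, so \<open>F\<close> and \<open>G\<close>
  agree in between; their third derivatives then force \<open>p f = q f\<close>.\<close>

lemma sturm_primitive_comparison:
  assumes F: "jacobi_on L p F f f'" and G: "jacobi_on L q G g g'"
    and pq: "\<And>t. 0 \<le> t \<Longrightarrow> t < L \<Longrightarrow> q t \<le> p t"
    and f_pos: "\<And>t. 0 < t \<Longrightarrow> t < L \<Longrightarrow> 0 < f t"
    and init: "F 0 = G 0" "f 0 = g 0" "f' 0 = g' 0"
    and pos0: "0 < g 0 \<or> g 0 = 0 \<and> 0 < g' 0"
    and s: "0 \<le> s" "s < L"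
  shows "F s \<le> G s" and "F s = G s \<Longrightarrow> 0 < t \<Longrightarrow> t < s \<Longrightarrow> p t = q t"
proof -
  have mono: "G a - F a \<le> G b - F b" if "0 \<le> a" "a \<le> b" "b < L" for a b
    using primitives_le[OF jacobi_onD(1)[OF F] jacobi_onD(1)[OF G]
        sturm_le[OF F G pq f_pos init(2,3) pos0]] that by blast
  show "F s \<le> G s" using mono[of 0 s] s init by simp
  assume eq: "F s = G s" and t: "0 < t" "t < s"
  have eq0: "F r = G r" if "0 < r" "r < s" for r
    using mono[of 0 r] mono[of r s] that s init eq by simp
  have eq1: "f r = g r" if "0 < r" "r < s" for r
    by (rule derivatives_eq_on_open_interval[OF eq0 jacobi_onD(1)[OF F] jacobi_onD(1)[OF G]])
      (use that s in auto)
  have eq2: "f' r = g' r" if "0 < r" "r < s" for r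
    by (rule derivatives_eq_on_open_interval[OF eq1 jacobi_onD(2)[OF F] jacobi_onD(2)[OF G]])
      (use that s in auto)
  have "- p t * f t = - q t * g t"
    by (rule derivatives_eq_on_open_interval[OF eq2 jacobi_onD(3)[OF F] jacobi_onD(3)[OF G]])
      (use t s in auto)
  then show "p t = q t" using eq1[OF t] f_pos[of t] t s by simp
qed

section \<open>The model functions of constant curvature\<close>

definition cosbar :: "real \<Rightarrow> real \<Rightarrow> real" where
  "cosbar k s = (if k > 0 then cos (sqrt k * s) else if k = 0 then 1 else cosh (sqrt \<bar>k\<bar> * s))"

lemma curvature_sign_cases:
  obtains r :: real where "r > 0" "k = r\<^sup>2" | "k = 0" | r :: real where "r > 0" "k = - r\<^sup>2"
proof -
  consider "k > 0" | "k = 0" | "k < 0" by linarith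
  then show thesis
  proof cases
    case 1
    with that(1)[of "sqrt k"] show ?thesis by simp
  next
    case 3
    with that(3)[of "sqrt (- k)"] show ?thesis by simp
  qed (rule that(2))
qed

lemma model_initial_values [simp]: "xbar k 0 = 0" "ybar k 0 = 0" "cosbar k 0 = 1"
  by (auto simp: xbar_def ybar_def cosbar_def)

lemma model_parity [simp]: "ybar k (- s) = ybar k s"
  by (auto simp: ybar_def)

lemma has_derivative_xbar: "(xbar k has_real_derivative cosbar k s) (at s)"
  by (cases k rule: curvature_sign_cases)
    (auto simp: xbar_def [abs_def] cosbar_def intro!: derivative_eq_intros)

lemma has_derivative_ybar: "(ybar k has_real_derivative xbar k s) (at s)"
  by (cases k rule: curvature_sign_cases)
    (auto simp: xbar_def ybar_def [abs_def] power2_eq_square intro!: derivative_eq_intros)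

lemma has_derivative_cosbar: "(cosbar k has_real_derivative - k * xbar k s) (at s)"
  by (cases k rule: curvature_sign_cases)
    (auto simp: xbar_def cosbar_def [abs_def] power2_eq_square intro!: derivative_eq_intros)

lemma jacobi_on_xbar: "jacobi_on L (\<lambda>_. k) (xbar k) (cosbar k) (\<lambda>s. - k * xbar k s)"
  unfolding jacobi_on_def
  by (intro ballI conjI has_derivative_xbar has_derivative_cosbar DERIV_cmult)

lemma jacobi_on_ybar: "jacobi_on L (\<lambda>_. k) (ybar k) (xbar k) (cosbar k)"
  unfolding jacobi_on_def
  by (intro ballI conjI has_derivative_ybar has_derivative_xbar has_derivative_cosbar)

text \<open>For \<open>k > 0\<close> the bound says that the first positive zero \<open>pi / (2 * sqrt k)\<close> of \<open>cosbar k\<close> is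
  not before \<open>L\<close>; that of \<open>xbar k\<close> is twice as far away.\<close>

lemma model_positive:
  assumes "L > 0" "k \<le> (pi / (2 * L))\<^sup>2" "0 \<le> s" "s < L"
  shows "0 < cosbar k s" and "0 < s \<Longrightarrow> 0 < xbar k s"
proof -
  have angle: "0 \<le> sqrt k * s" "sqrt k * s < pi / 2" if "k > 0"
  proof -
    have "sqrt k \<le> pi / (2 * L)" using assms by (intro real_le_lsqrt) auto
    then have "sqrt k * L \<le> pi / 2" using \<open>L > 0\<close> by (simp add: field_simps)
    moreover have "sqrt k * s < sqrt k * L" using assms that by simp
    ultimately show "sqrt k * s < pi / 2" by linarith
  qed (use assms that in simp)
  consider "k > 0" | "k = 0" | "k < 0" by linarith
  then show "0 < cosbar k s"
    by cases (use angle in \<open>auto simp: cosbar_def intro: cos_gt_zero_pi\<close>)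
  assume "0 < s"
  consider "k > 0" | "k = 0" | "k < 0" by linarith
  then show "0 < xbar k s"
  proof cases
    case 1
    with angle \<open>0 < s\<close> pi_gt_zero have "0 < sqrt k * s" "sqrt k * s < pi" by (simp, linarith)
    with 1 show ?thesis by (simp add: xbar_def sin_gt_zero)
  qed (use \<open>0 < s\<close> in \<open>auto simp: xbar_def\<close>)
qed

text \<open>The bound by the larger constant \<open>k\<^sub>1\<close> is proved first, because it yields the positivity of
  the velocities that the comparison with \<open>k0\<close> presupposes.\<close>

lemma model_bounds:
  assumes X: "jacobi_on L \<kappa> X U U'" and Y: "jacobi_on L \<kappa> Y V V'"
    and init: "X 0 = 0" "U 0 = 1" "U' 0 = 0" "Y 0 = 0" "V 0 = 0" "V' 0 = 1"
    and \<kappa>: "\<forall>t\<in>{0..<L}. k\<^sub>0 \<le> \<kappa> t \<and> \<kappa> t \<le> k\<^sub>1"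
    and L: "L > 0" "k\<^sub>1 \<le> (pi / (2 * L))\<^sup>2"
    and s: "0 \<le> s" "s < L"
  shows "0 < U s"
    and "0 \<le> X s" "xbar k\<^sub>1 s \<le> X s" "X s \<le> xbar k\<^sub>0 s"
    and "ybar k\<^sub>1 s \<le> Y s" "Y s \<le> ybar k\<^sub>0 s"
    and "xbar k\<^sub>1 s = X s \<or> ybar k\<^sub>1 s = Y s \<Longrightarrow> 0 < t \<Longrightarrow> t < s \<Longrightarrow> \<kappa> t = k\<^sub>1"
    and "X s = xbar k\<^sub>0 s \<or> Y s = ybar k\<^sub>0 s \<Longrightarrow> 0 < t \<Longrightarrow> t < s \<Longrightarrow> \<kappa> t = k\<^sub>0"
proof -
  have \<kappa>1: "\<kappa> r \<le> k\<^sub>1" and \<kappa>0: "k\<^sub>0 \<le> \<kappa> r" if "0 \<le> r" "r < L" for r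
    using \<kappa> that by auto
  have cos_pos: "0 < cosbar k\<^sub>1 r" and x_pos: "0 < xbar k\<^sub>1 r" if "0 < r" "r < L" for r
    using model_positive[OF L, of r] that by auto
  have U_pos: "0 < U r" if "0 < r" "r < L" for r
    by (rule sturm_positive[OF jacobi_on_xbar X \<kappa>1 cos_pos]) (use that init in auto)
  have V_pos: "0 < V r" if "0 < r" "r < L" for r
    by (rule sturm_positive[OF jacobi_on_ybar Y \<kappa>1 x_pos]) (use that init in auto)
  show "0 < U s" using U_pos[of s] init s by (cases "s = 0") auto
  note lower_x = sturm_primitive_comparison[OF jacobi_on_xbar X \<kappa>1 cos_pos _ _ _ _ s]
  note lower_y = sturm_primitive_comparison[OF jacobi_on_ybar Y \<kappa>1 x_pos _ _ _ _ s]
  note upper_x = sturm_primitive_comparison[OF X jacobi_on_xbar \<kappa>0 U_pos _ _ _ _ s]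
  note upper_y = sturm_primitive_comparison[OF Y jacobi_on_ybar \<kappa>0 V_pos _ _ _ _ s]
  show low: "xbar k\<^sub>1 s \<le> X s" by (rule lower_x(1)) (simp_all add: init)
  then show "0 \<le> X s" using x_pos[of s] s init by (cases "s = 0") auto
  show "X s \<le> xbar k\<^sub>0 s" by (rule upper_x(1)) (simp_all add: init)
  show "ybar k\<^sub>1 s \<le> Y s" by (rule lower_y(1)) (simp_all add: init)
  show "Y s \<le> ybar k\<^sub>0 s" by (rule upper_y(1)) (simp_all add: init)
  assume t: "0 < t" "t < s"
  show "\<kappa> t = k\<^sub>1" if "xbar k\<^sub>1 s = X s \<or> ybar k\<^sub>1 s = Y s"
    using that
  proof
    assume eq: "xbar k\<^sub>1 s = X s"
    show ?thesis by (rule lower_x(2)[where t = t, symmetric]) (simp_all add: init t eq)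
  next
    assume eq: "ybar k\<^sub>1 s = Y s"
    show ?thesis by (rule lower_y(2)[where t = t, symmetric]) (simp_all add: init t eq)
  qed
  show "\<kappa> t = k\<^sub>0" if "X s = xbar k\<^sub>0 s \<or> Y s = ybar k\<^sub>0 s"
    using that
  proof
    assume eq: "X s = xbar k\<^sub>0 s"
    show ?thesis by (rule upper_x(2)[where t = t]) (simp_all add: init t eq)
  next
    assume eq: "Y s = ybar k\<^sub>0 s"
    show ?thesis by (rule upper_y(2)[where t = t]) (simp_all add: init t eq)
  qed
qed

section \<open>Derivatives within the parameter interval\<close>

lemma deriv_on_Suc: "deriv_on I (Suc n) c t = vector_derivative (deriv_on I n c) (at t within I)"
  by (simp add: deriv_on_def)

lemma deriv_on_0: "deriv_on I 0 c = c"
  by (simp add: deriv_on_def)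

lemma has_vector_derivative_deriv_on:
  assumes "C_k_on k c I" "n < k" "t \<in> I"
  shows "(deriv_on I n c has_vector_derivative deriv_on I (Suc n) c t) (at t within I)"
  using assms by (auto simp: C_k_on_def deriv_on_Suc vector_derivative_works)

lemma interval_no_isolated_points:
  fixes J :: "real set"
  assumes "is_interval J" "a \<in> J" "b \<in> J" "a \<noteq> b" "t \<in> J"
  shows "at t within J \<noteq> bot"
proof -
  have "t islimpt J"
    using assms by (intro connected_imp_perfect) (auto simp: is_interval_connected_1)
  then show ?thesis by (simp add: trivial_limit_within)
qed

text \<open>Derivatives within a set depend on the set, but passing to a subset without isolated points
  keeps them: the derivative within the larger set still is one within the subset, and there it is
  unique.\<close>

lemma deriv_on_restrict:
  assumes c: "C_k_on k c I" and "J \<subseteq> I" and J: "\<And>t. t \<in> J \<Longrightarrow> at t within J \<noteq> bot"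
    and "n \<le> k" "t \<in> J"
  shows "deriv_on J n c t = deriv_on I n c t"
  using \<open>n \<le> k\<close> \<open>t \<in> J\<close>
proof (induction n arbitrary: t)
  case (Suc n)
  have "(deriv_on I n c has_vector_derivative deriv_on I (Suc n) c t) (at t within J)"
    by (rule has_vector_derivative_within_subset[OF has_vector_derivative_deriv_on[OF c]])
      (use Suc.prems \<open>J \<subseteq> I\<close> in auto)
  then have "(deriv_on J n c has_vector_derivative deriv_on I (Suc n) c t) (at t within J)"
    by (rule has_vector_derivative_transform[OF \<open>t \<in> J\<close>, rotated])
      (simp add: Suc.IH Suc_leD[OF \<open>Suc n \<le> k\<close>])
  from vector_derivative_within[OF J[OF \<open>t \<in> J\<close>] this]
  show ?case by (rule trans[OF deriv_on_Suc])
qed (simp add: deriv_on_0)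

lemma C_k_on_restrict:
  assumes c: "C_k_on k c I" and "J \<subseteq> I" and J: "\<And>t. t \<in> J \<Longrightarrow> at t within J \<noteq> bot"
  shows "C_k_on k c J"
proof -
  have eq: "deriv_on J n c t = deriv_on I n c t" if "n \<le> k" "t \<in> J" for n t
    by (rule deriv_on_restrict[OF assms that])
  have "deriv_on J n c differentiable (at t within J)" if "n < k" "t \<in> J" for n t
  proof -
    have "deriv_on I n c differentiable (at t within J)"
      using c that \<open>J \<subseteq> I\<close> by (auto simp: C_k_on_def intro: differentiable_within_subset)
    then obtain D where "(deriv_on I n c has_derivative D) (at t within J)"
      by (auto simp: differentiable_def)
    then have "(deriv_on J n c has_derivative D) (at t within J)"
      by (rule has_derivative_transform[OF \<open>t \<in> J\<close>, rotated])
        (use that eq in auto)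
    then show ?thesis by (rule differentiableI)
  qed
  moreover have "continuous_on J (deriv_on J n c)" if "n \<le> k" for n
  proof -
    have "continuous_on J (deriv_on I n c)"
      using c that \<open>J \<subseteq> I\<close> by (auto simp: C_k_on_def intro: continuous_on_subset)
    then show ?thesis by (rule continuous_on_eq) (simp add: eq that)
  qed
  ultimately show ?thesis by (simp add: C_k_on_def)
qed

section \<open>The affine frame and the affine curvature\<close>

lemma bounded_bilinear_wedge: "bounded_bilinear wedge"
  unfolding bilinear_conv_bounded_bilinear [symmetric] bilinear_def
  by (auto intro!: linearI simp: wedge_def algebra_simps)

lemmas wedge_simps = bounded_bilinear.add_left[OF bounded_bilinear_wedge]
  bounded_bilinear.add_right[OF bounded_bilinear_wedge]
  bounded_bilinear.scaleR_left[OF bounded_bilinear_wedge]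
  bounded_bilinear.scaleR_right[OF bounded_bilinear_wedge]

lemma wedge_self [simp]: "wedge v v = 0"
  by (simp add: wedge_def)

lemma wedge_commute: "wedge v w = - wedge w v"
  by (simp add: wedge_def)

text \<open>This is Cramer's rule for a basis of unit area.\<close>

lemma wedge_frame_expansion:
  assumes "wedge a b = 1"
  shows "v = wedge v b *\<^sub>R a + wedge a v *\<^sub>R b"
proof -
  have "v $ i * wedge a b = (wedge v b *\<^sub>R a + wedge a v *\<^sub>R b) $ i" for i
    using exhaust_2[of i] by (auto simp: wedge_def algebra_simps)
  then show ?thesis unfolding assms mult_1_right vec_eq_iff by blast
qed

lemma frame_coordinates:
  assumes "wedge a b = 1" "p = p\<^sub>0 + u *\<^sub>R a + v *\<^sub>R b"
  shows "u = wedge (p - p\<^sub>0) b" "v = wedge a (p - p\<^sub>0)"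
  using assms by (simp_all add: wedge_simps)

text \<open>Differentiating \<open>c' \<wedge> c'' = 1\<close> gives \<open>c' \<wedge> c''' = 0\<close>, so only the \<open>c'\<close> component of \<open>c'''\<close>
  remains in its expansion in the frame \<open>c', c''\<close>. The formula for the curvature shows in
  addition that it is continuous.\<close>

lemma affine_curvature:
  assumes c: "affine_unit_speed I c" and "at t within I \<noteq> bot" "t \<in> I"
  shows "affine_curvature I c t = wedge (deriv_on I 2 c t) (deriv_on I 3 c t)"
    and "deriv_on I 3 c t = - affine_curvature I c t *\<^sub>R deriv_on I 1 c t"
proof -
  have C3: "C_k_on 3 c I" and unit: "\<And>s. s \<in> I \<Longrightarrow> wedge (deriv_on I 1 c s) (deriv_on I 2 c s) = 1"
    using c by (auto simp: affine_unit_speed_def)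
  have "((\<lambda>s. wedge (deriv_on I 1 c s) (deriv_on I 2 c s)) has_vector_derivative
      wedge (deriv_on I 1 c t) (deriv_on I 3 c t)) (at t within I)"
    using bounded_bilinear.has_vector_derivative[OF bounded_bilinear_wedge
        has_vector_derivative_deriv_on[OF C3, of 1 t] has_vector_derivative_deriv_on[OF C3, of 2 t]]
      \<open>t \<in> I\<close> by (simp add: numeral_2_eq_2 numeral_3_eq_3)
  moreover have "((\<lambda>s. wedge (deriv_on I 1 c s) (deriv_on I 2 c s)) has_vector_derivative 0)
      (at t within I)"
    by (rule has_vector_derivative_transform[OF \<open>t \<in> I\<close>, where f = "\<lambda>_. 1"])
      (simp_all only: unit has_vector_derivative_const)
  ultimately have ortho: "wedge (deriv_on I 1 c t) (deriv_on I 3 c t) = 0"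
    by (rule vector_derivative_unique_within[OF assms(2)])
  have "deriv_on I 3 c t = wedge (deriv_on I 3 c t) (deriv_on I 2 c t) *\<^sub>R deriv_on I 1 c t
      + wedge (deriv_on I 1 c t) (deriv_on I 3 c t) *\<^sub>R deriv_on I 2 c t"
    by (rule wedge_frame_expansion[OF unit[OF \<open>t \<in> I\<close>]])
  also have "\<dots> = - wedge (deriv_on I 2 c t) (deriv_on I 3 c t) *\<^sub>R deriv_on I 1 c t"
    by (simp only: ortho wedge_commute[of "deriv_on I 3 c t" "deriv_on I 2 c t"]
        scaleR_zero_left add_0_right)
  finally have eq: "deriv_on I 3 c t
      = - wedge (deriv_on I 2 c t) (deriv_on I 3 c t) *\<^sub>R deriv_on I 1 c t" .
  have "deriv_on I 1 c t \<noteq> 0" using unit[OF \<open>t \<in> I\<close>] by (auto simp: wedge_def)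
  with eq show curv: "affine_curvature I c t = wedge (deriv_on I 2 c t) (deriv_on I 3 c t)"
    unfolding affine_curvature_def
    by (intro the_equality) (simp, metis neg_equal_iff_equal scaleR_cancel_right)
  show "deriv_on I 3 c t = - affine_curvature I c t *\<^sub>R deriv_on I 1 c t"
    using eq by (simp only: curv)
qed

lemma constant_affine_curvature_restrict:
  assumes c: "affine_unit_speed I c" and "J \<subseteq> I" and J: "\<And>t. t \<in> J \<Longrightarrow> at t within J \<noteq> bot"
    and \<kappa>: "\<And>t. t \<in> J \<Longrightarrow> affine_curvature I c t = k"
  shows "constant_affine_curvature J c k"
proof -
  have C3: "C_k_on 3 c I" using c by (simp add: affine_unit_speed_def)
  have eq: "deriv_on J n c t = deriv_on I n c t" if "n \<le> 3" "t \<in> J" for n t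
    by (rule deriv_on_restrict[OF C3 \<open>J \<subseteq> I\<close> J that])
  have "affine_unit_speed J c"
    using c eq C_k_on_restrict[OF C3 \<open>J \<subseteq> I\<close> J] \<open>J \<subseteq> I\<close>
    by (auto simp: affine_unit_speed_def)
  moreover have "affine_curvature J c t = k" if "t \<in> J" for t
    using \<kappa>[OF that] eq that by (simp add: affine_curvature_def)
  ultimately show ?thesis by (simp add: constant_affine_curvature_def)
qed

section \<open>Graphing intervals\<close>

text \<open>Injectivity makes the ordinate a function of the abscissa. Both directions rest on the fact
  that the two coordinates determine a point: otherwise \<open>S\<close> could miss a point with the same
  coordinates as one of its own, or contain both.\<close>

lemma is_graph_in_iff_inj_on:
  assumes coords: "\<And>p q. \<xi> p = \<xi> q \<Longrightarrow> \<eta> p = \<eta> q \<Longrightarrow> p = q"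
  shows "is_graph_in \<xi> \<eta> S \<longleftrightarrow> inj_on \<xi> S"
proof
  assume "is_graph_in \<xi> \<eta> S"
  then show "inj_on \<xi> S" unfolding is_graph_in_def by (auto intro!: inj_onI coords)
next
  assume "inj_on \<xi> S"
  have "p \<in> S \<longleftrightarrow> \<xi> p \<in> \<xi> ` S \<and> \<eta> p = (\<eta> \<circ> inv_into S \<xi>) (\<xi> p)" for p
  proof (intro iffI conjI)
    assume "\<xi> p \<in> \<xi> ` S \<and> \<eta> p = (\<eta> \<circ> inv_into S \<xi>) (\<xi> p)"
    then have "inv_into S \<xi> (\<xi> p) = p" by (intro coords) (auto simp: f_inv_into_f)
    with \<open>\<xi> p \<in> \<xi> ` S \<and> _\<close> show "p \<in> S" by (metis inv_into_into)
  qed (simp_all add: inv_into_f_f[OF \<open>inj_on \<xi> S\<close>])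
  then have "S = {p. \<xi> p \<in> \<xi> ` S \<and> \<eta> p = (\<eta> \<circ> inv_into S \<xi>) (\<xi> p)}" by blast
  then show "is_graph_in \<xi> \<eta> S" unfolding is_graph_in_def by blast
qed

text \<open>If two values agree, then, as in Rolle's theorem, there is an extremum strictly between
  them, and near an interior extremum a continuous function is not injective.\<close>

lemma locally_injective_imp_injective:
  fixes f :: "real \<Rightarrow> real"
  assumes J: "is_interval J" and cont: "continuous_on J f"
    and loc: "\<And>t. t \<in> J \<Longrightarrow> \<exists>d>0. inj_on f (J \<inter> ball t d)"
  shows "inj_on f J"
proof (rule linorder_inj_onI')
  fix a b assume ab: "a \<in> J" "b \<in> J" "a < b"
  show "f a \<noteq> f b"
  proof
    assume eq: "f a = f b"
    have sub: "{a..b} \<subseteq> J" using mem_is_interval_1_I[OF J ab(1,2)] by auto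
    then have cont_ab: "continuous_on {a..b} f" by (rule continuous_on_subset[OF cont])
    have "{a..b} \<noteq> {}" using ab by simp
    obtain M where M: "M \<in> {a..b}" "\<And>t. t \<in> {a..b} \<Longrightarrow> f t \<le> f M"
      using continuous_attains_sup[OF compact_Icc \<open>{a..b} \<noteq> {}\<close> cont_ab] by blast
    obtain N where N: "N \<in> {a..b}" "\<And>t. t \<in> {a..b} \<Longrightarrow> f N \<le> f t"
      using continuous_attains_inf[OF compact_Icc \<open>{a..b} \<noteq> {}\<close> cont_ab] by blast
    have "\<exists>m. a < m \<and> m < b \<and> ((\<forall>t\<in>{a..b}. f t \<le> f m) \<or> (\<forall>t\<in>{a..b}. f m \<le> f t))"
    proof (cases "M \<in> {a, b} \<and> N \<in> {a, b}")
      case True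
      then have "f M = f a" "f N = f a" using eq by auto
      with M(2) N(2) have const: "f t = f a" if "t \<in> {a..b}" for t
        using that by (intro antisym) auto
      define m where "m = (a + b) / 2"
      have m: "a < m" "m < b" using ab by (auto simp: m_def)
      then have "m \<in> {a..b}" by simp
      have "f t \<le> f m" if "t \<in> {a..b}" for t
        using const[OF that] const[OF \<open>m \<in> {a..b}\<close>] by linarith
      with m show ?thesis by blast
    next
      case False
      then show ?thesis
      proof (cases "M \<in> {a, b}")
        case True
        with False N(1) have "a < N" "N < b" by auto
        with N(2) show ?thesis by blast
      next
        case False
        with M(1) have "a < M" "M < b" by auto
        with M(2) show ?thesis by blast
      qed
    qed
    then obtain m where m: "a < m" "m < b"
      and ext: "(\<forall>t\<in>{a..b}. f t \<le> f m) \<or> (\<forall>t\<in>{a..b}. f m \<le> f t)" by blast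
    have "m \<in> {a..b}" using m by simp
    with sub have "m \<in> J" by blast
    then obtain d where d: "d > 0" "inj_on f (J \<inter> ball m d)" using loc by blast
    define e where "e = min (d / 2) (min (m - a) (b - m))"
    have e: "0 < e" "{m - e..m + e} \<subseteq> {a..b}" "{m - e..m + e} \<subseteq> ball m d"
    proof -
      have "0 < e" "e \<le> m - a" "e \<le> b - m" "e < d" using d m by (auto simp: e_def)
      then show "0 < e" "{m - e..m + e} \<subseteq> {a..b}" "{m - e..m + e} \<subseteq> ball m d"
        by (auto simp: dist_real_def)
    qed
    have "inj_on f {m - e..m + e}" using e sub by (intro inj_on_subset[OF d(2)]) auto
    moreover have "continuous_on {m - e..m + e} f" using e by (intro continuous_on_subset[OF cont_ab])
    ultimately have "f (m - e) < f m \<and> f m < f (m + e) \<or> f (m + e) < f m \<and> f m < f (m - e)"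
      using e by (intro continuous_inj_imp_mono) auto
    moreover have "m - e \<in> {a..b}" "m + e \<in> {a..b}" using e by auto
    ultimately show False using ext by force
  qed
qed

text \<open>Near \<open>t\<close> the velocity has positive inner product with \<open>c' t\<close>, so \<open>c\<close> moves forward in
  that direction.\<close>

lemma regular_curve_locally_injective:
  fixes c :: "real \<Rightarrow> 'a::real_inner"
  assumes I: "is_interval I" and "t \<in> I"
    and deriv: "\<And>s. s \<in> I \<Longrightarrow> (c has_vector_derivative c' s) (at s within I)"
    and cont: "continuous_on I c'" and "c' t \<noteq> 0"
  shows "\<exists>d>0. inj_on c (I \<inter> ball t d)"
proof -
  have "continuous_on I (\<lambda>s. c' s \<bullet> c' t)" by (intro continuous_intros cont)
  then have "((\<lambda>s. c' s \<bullet> c' t) \<longlongrightarrow> c' t \<bullet> c' t) (at t within I)"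
    using \<open>t \<in> I\<close> by (simp add: continuous_on_def)
  then have "eventually (\<lambda>s. 0 < c' s \<bullet> c' t) (at t within I)"
    using \<open>c' t \<noteq> 0\<close> by (intro order_tendstoD) auto
  then obtain d where "d > 0"
    and near: "\<And>s. s \<in> I \<Longrightarrow> s \<noteq> t \<Longrightarrow> dist s t < d \<Longrightarrow> 0 < c' s \<bullet> c' t"
    unfolding eventually_at by blast
  have d: "0 < c' s \<bullet> c' t" if "s \<in> I" "dist s t < d" for s
    using near[OF that(1) _ that(2)] \<open>c' t \<noteq> 0\<close> by (cases "s = t") auto
  have "inj_on c (I \<inter> ball t d)"
  proof (rule linorder_inj_onI')
    fix a b assume ab: "a \<in> I \<inter> ball t d" "b \<in> I \<inter> ball t d" "a < b"
    then have sub: "{a..b} \<subseteq> I" "{a..b} \<subseteq> ball t d"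
      using mem_is_interval_1_I[OF I, of a b] mem_is_interval_1_I[OF is_interval_ball_real, of a t d b]
      by auto
    have "((\<lambda>s. c s \<bullet> c' t) has_derivative (\<lambda>h. h * (c' s \<bullet> c' t))) (at s within {a..b})"
      if "a \<le> s" "s \<le> b" for s
    proof -
      have "s \<in> I" using that sub(1) by auto
      then have "(c has_derivative (\<lambda>h. h *\<^sub>R c' s)) (at s within {a..b})"
        using has_vector_derivative_within_subset[OF deriv sub(1)]
        by (simp add: has_vector_derivative_def)
      from bounded_linear.has_derivative[OF bounded_linear_inner_left this, of "c' t"]
      show ?thesis by simp
    qed
    from mvt_simple[OF ab(3) this] obtain s where "s \<in> {a<..<b}"
      and "c b \<bullet> c' t - c a \<bullet> c' t = (b - a) * (c' s \<bullet> c' t)" by blast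
    moreover have "s \<in> {a..b}" using \<open>s \<in> {a<..<b}\<close> by auto
    with sub have "s \<in> I \<inter> ball t d" by blast
    then have "0 < (b - a) * (c' s \<bullet> c' t)"
      using \<open>a < b\<close> by (intro mult_pos_pos d) (auto simp: dist_commute)
    ultimately show "c a \<noteq> c b" by auto
  qed
  with \<open>d > 0\<close> show ?thesis by blast
qed

text \<open>Call an interval \<open>J\<close> through \<open>0\<close> admissible if its image is a graph. On it the abscissa is
  injective, first locally because \<open>c\<close> is, then globally; hence it is monotone, and it increases
  because it does so near \<open>0\<close>. Conversely an increasing abscissa makes \<open>J\<close> admissible. Two
  intervals with common point \<open>0\<close> on which a function increases have a union on which it increases,
  so the union of all admissible intervals is the greatest one.\<close>

lemma subset_graphing_parameter_set:
  assumes coords: "\<And>p q. \<xi> p = \<xi> q \<Longrightarrow> \<eta> p = \<eta> q \<Longrightarrow> p = q"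
    and cont: "continuous_on I (\<lambda>s. \<xi> (c s))"
    and loc: "\<And>t. t \<in> I \<Longrightarrow> \<exists>d>0. inj_on c (I \<inter> ball t d)"
    and "L > 0" "{-L<..<L} \<subseteq> I"
    and mono: "strict_mono_on {-L<..<L} (\<lambda>s. \<xi> (c s))"
  shows "{-L<..<L} \<subseteq> graphing_parameter_set I c \<xi> \<eta>"
proof -
  let ?x = "\<lambda>s. \<xi> (c s)"
  let ?adm = "\<lambda>J. J \<subseteq> I \<and> is_interval J \<and> 0 \<in> J \<and> is_graph_in \<xi> \<eta> (c ` J)"
  have graph_inj: "is_graph_in \<xi> \<eta> S \<longleftrightarrow> inj_on \<xi> S" for S
    by (rule is_graph_in_iff_inj_on) (rule coords)
  have graph_iff: "is_graph_in \<xi> \<eta> (c ` J) \<longleftrightarrow> strict_mono_on J ?x"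
    if J: "J \<subseteq> I" "is_interval J" "0 \<in> J" for J
    unfolding graph_inj
  proof
    assume "strict_mono_on J ?x"
    then have "inj_on ?x J" by (rule strict_mono_on_imp_inj_on)
    then show "inj_on \<xi> (c ` J)" by (auto simp: inj_on_def)
  next
    assume inj: "inj_on \<xi> (c ` J)"
    have cont_J: "continuous_on J ?x" using continuous_on_subset[OF cont J(1)] .
    have "inj_on ?x J"
    proof (rule locally_injective_imp_injective[OF J(2) cont_J])
      fix t assume "t \<in> J"
      with J loc obtain d where d: "d > 0" "inj_on c (I \<inter> ball t d)" by blast
      have "inj_on c (J \<inter> ball t d)" using J(1) by (intro inj_on_subset[OF d(2)]) auto
      moreover have "inj_on \<xi> (c ` (J \<inter> ball t d))" by (intro inj_on_subset[OF inj]) auto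
      ultimately have "inj_on ?x (J \<inter> ball t d)" using comp_inj_on by (force simp: comp_def)
      with d show "\<exists>d>0. inj_on ?x (J \<inter> ball t d)" by blast
    qed
    then have "strict_mono_on J ?x \<or> strict_antimono_on J ?x"
      using injective_eq_monotone_map[OF J(2) cont_J] by simp
    then show "strict_mono_on J ?x"
    proof
      assume anti: "strict_antimono_on J ?x"
      have "t = 0" if "t \<in> J" for t
      proof (rule ccontr)
        assume "t \<noteq> 0"
        \<comment> \<open>A point other than 0 that lies both in J and in the interval where x increases.\<close>
        define r where "r = (if 0 < t then min t (L / 2) else max t (- L / 2))"
        have between: "0 \<le> r \<and> r \<le> t \<or> t \<le> r \<and> r \<le> 0"
          and r0: "r \<noteq> 0" "r \<in> {-L<..<L}"
          using \<open>t \<noteq> 0\<close> \<open>L > 0\<close> by (auto simp: r_def)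
        from between have "r \<in> J"
          using mem_is_interval_1_I[OF J(2,3) that] mem_is_interval_1_I[OF J(2) that J(3)] by blast
        note r = this r0
        consider "r < 0" | "0 < r" using r by linarith
        then show False
        proof cases
          case 1
          then show ?thesis
            using strict_mono_onD[OF mono, of r 0] monotone_onD[OF anti, of r 0] r J \<open>L > 0\<close>
            by auto
        next
          case 2
          then show ?thesis
            using strict_mono_onD[OF mono, of 0 r] monotone_onD[OF anti, of 0 r] r J \<open>L > 0\<close>
            by auto
        qed
      qed
      then show ?thesis by (auto intro!: strict_mono_onI)
    qed
  qed
  then have adm_iff: "?adm J \<longleftrightarrow> J \<subseteq> I \<and> is_interval J \<and> 0 \<in> J \<and> strict_mono_on J ?x" for J
    by blast
  define G where "G = \<Union> (Collect ?adm)"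
  have "?adm G"
    unfolding adm_iff
  proof (intro conjI)
    have adm_K: "?adm {-L<..<L}"
      unfolding adm_iff using assms by (auto simp: is_interval_1)
    then show "0 \<in> G" unfolding G_def by blast
    show "G \<subseteq> I" by (auto simp: G_def)
    show "is_interval G"
      unfolding G_def is_interval_connected_1
      by (rule connected_Union) (use adm_K in \<open>auto simp: is_interval_connected_1\<close>)
    show "strict_mono_on G ?x"
    proof (rule strict_mono_onI)
      fix a b assume "a \<in> G" "b \<in> G" "a < b"
      then obtain A B where A: "a \<in> A" "?adm A" and B: "b \<in> B" "?adm B" by (auto simp: G_def)
      consider "b \<le> 0" | "0 \<le> a" | "a < 0" "0 < b" by linarith
      then show "?x a < ?x b"
      proof cases
        case 1
        with A \<open>a < b\<close> have "b \<in> A" using mem_is_interval_1_I[of A a 0 b] by simp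
        with A \<open>a < b\<close> show ?thesis unfolding adm_iff by (blast dest: strict_mono_onD)
      next
        case 2
        with B \<open>a < b\<close> have "a \<in> B" using mem_is_interval_1_I[of B 0 b a] by simp
        with B \<open>a < b\<close> show ?thesis unfolding adm_iff by (blast dest: strict_mono_onD)
      next
        case 3
        have "?x a < ?x 0" "?x 0 < ?x b"
          using A B 3 unfolding adm_iff by (blast dest: strict_mono_onD)+
        then show ?thesis by simp
      qed
    qed
  qed
  then have "graphing_parameter_set I c \<xi> \<eta> = G"
    unfolding graphing_parameter_set_def by (rule Greatest_equality) (auto simp: G_def)
  moreover have "?adm {-L<..<L}"
    unfolding adm_iff using assms by (auto simp: is_interval_1)
  ultimately show ?thesis unfolding G_def by blast
qed

section \<open>The curve in adapted coordinates\<close>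

text \<open>Comparison runs to the right of \<open>0\<close>, so the left half of the curve is reflected. Of the two
  reflected primitives the one without sign suits the ordinate, whose model \<open>ybar k\<close> is even, and
  the other one suits the abscissa, whose model \<open>xbar k\<close> is odd.\<close>

lemma jacobi_on_both_sides:
  assumes "\<And>t. t \<in> {-L<..<L} \<Longrightarrow> (F has_real_derivative f t) (at t)"
    and "\<And>t. t \<in> {-L<..<L} \<Longrightarrow> (f has_real_derivative f' t) (at t)"
    and "\<And>t. t \<in> {-L<..<L} \<Longrightarrow> (f' has_real_derivative - p t * f t) (at t)"
  shows "jacobi_on L p F f f'"
    and "jacobi_on L (\<lambda>t. p (- t)) (\<lambda>t. F (- t)) (\<lambda>t. - f (- t)) (\<lambda>t. f' (- t))"
    and "jacobi_on L (\<lambda>t. p (- t)) (\<lambda>t. - F (- t)) (\<lambda>t. f (- t)) (\<lambda>t. - f' (- t))"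
proof -
  show "jacobi_on L p F f f'" using assms by (simp add: jacobi_on_def)
  have mirror: "((\<lambda>t. h (- t)) has_real_derivative - m) (at t)"
      "((\<lambda>t. - h (- t)) has_real_derivative m) (at t)"
    if "(h has_real_derivative m) (at (- t))" for h m t
    using that DERIV_minus[of "\<lambda>t. h (- t)" "- m" t UNIV] by (simp_all add: DERIV_mirror)
  have mem: "- t \<in> {-L<..<L}" if "t \<in> {0..<L}" for t using that by auto
  show "jacobi_on L (\<lambda>t. p (- t)) (\<lambda>t. F (- t)) (\<lambda>t. - f (- t)) (\<lambda>t. f' (- t))"
    and "jacobi_on L (\<lambda>t. p (- t)) (\<lambda>t. - F (- t)) (\<lambda>t. f (- t)) (\<lambda>t. - f' (- t))"
    unfolding jacobi_on_def
    using mirror[OF assms(1)[OF mem]] mirror[OF assms(2)[OF mem]] mirror[OF assms(3)[OF mem]]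
    by simp_all
qed

theorem theorem5p5:
  fixes C :: "(real^2) set" and p\<^sub>0 :: "real^2"
    and I :: "real set" and c :: "real \<Rightarrow> real^2"
    and \<xi> \<eta> :: "real^2 \<Rightarrow> real"
    and L k\<^sub>0 k\<^sub>1 :: real and x y :: "real \<Rightarrow> real"
  assumes "convex_curve 4 C" and "p\<^sub>0 \<in> C"
    and "standard_parameterization C p\<^sub>0 I c"
    and "L > 0" and "{-L<..<L} \<subseteq> I"
    and "\<forall>s\<in>I. -L \<le> s \<and> s \<le> L \<longrightarrow> k\<^sub>0 \<le> affine_curvature I c s \<and> affine_curvature I c s \<le> k\<^sub>1"
    and "k\<^sub>1 \<le> (pi / (2 * L))\<^sup>2"
    and "affine_adapted_coordinates p\<^sub>0 I c \<xi> \<eta>"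
    and "x = (\<lambda>s. \<xi> (c s))" and "y = (\<lambda>s. \<eta> (c s))"
  shows "{-L<..<L} \<subseteq> graphing_parameter_set I c \<xi> \<eta> \<and>
    (\<forall>s\<in>{-L<..<L}. xbar k\<^sub>1 \<bar>s\<bar> \<le> \<bar>x s\<bar> \<and> \<bar>x s\<bar> \<le> xbar k\<^sub>0 \<bar>s\<bar>) \<and>
    (\<forall>s\<in>{-L<..<L}. ybar k\<^sub>1 s \<le> y s \<and> y s \<le> ybar k\<^sub>0 s) \<and>
    (let R = xbar k\<^sub>1 L in {-R<..<R} \<subseteq> graphing_interval I c \<xi> \<eta>) \<and>
    (\<forall>s\<^sub>1\<in>{-L<..<L}. s\<^sub>1 \<noteq> 0 \<longrightarrow>
       (xbar k\<^sub>1 \<bar>s\<^sub>1\<bar> = \<bar>x s\<^sub>1\<bar> \<or> ybar k\<^sub>1 s\<^sub>1 = y s\<^sub>1 \<longrightarrow>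
          constant_affine_curvature (closed_segment 0 s\<^sub>1) c k\<^sub>1) \<and>
       (\<bar>x s\<^sub>1\<bar> = xbar k\<^sub>0 \<bar>s\<^sub>1\<bar> \<or> y s\<^sub>1 = ybar k\<^sub>0 s\<^sub>1 \<longrightarrow>
          constant_affine_curvature (closed_segment 0 s\<^sub>1) c k\<^sub>0))"
proof -
  let ?e\<^sub>1 = "deriv_on I 1 c 0" and ?e\<^sub>2 = "deriv_on I 2 c 0"
  let ?K = "{-L<..<L}"
  let ?\<kappa> = "affine_curvature I c"
  note L = \<open>L > 0\<close> \<open>k\<^sub>1 \<le> (pi / (2 * L))\<^sup>2\<close>
  from \<open>standard_parameterization C p\<^sub>0 I c\<close>
  have I: "is_interval I" and "0 \<in> I" and speed: "affine_unit_speed I c" and c0: "c 0 = p\<^sub>0"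
    by (auto simp: standard_parameterization_def)
  have C3: "C_k_on 3 c I" using speed by (simp add: affine_unit_speed_def)
  have unit: "wedge (deriv_on I 1 c t) (deriv_on I 2 c t) = 1" if "t \<in> I" for t
    using speed that by (simp add: affine_unit_speed_def)
  have K_sub: "?K \<subseteq> I" by fact
  have K_half: "0 \<in> ?K" "L / 2 \<in> ?K" using \<open>L > 0\<close> by auto
  have nbot: "at t within I \<noteq> bot" if "t \<in> I" for t
    by (rule interval_no_isolated_points[OF I _ _ _ that, of 0 "L / 2"]) (use K_sub K_half L in auto)

  \<comment> \<open>Interior points of the parameter interval have ordinary derivatives.\<close>
  have deriv: "(deriv_on I n c has_vector_derivative deriv_on I (Suc n) c t) (at t)"
    if "n < 3" "t \<in> ?K" for n t
  proof -
    have "t \<in> interior I"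
      using interior_maximal[OF K_sub open_greaterThanLessThan] \<open>t \<in> ?K\<close> by blast
    have "t \<in> I" using K_sub \<open>t \<in> ?K\<close> by blast
    from has_vector_derivative_deriv_on[OF C3 \<open>n < 3\<close> this] show ?thesis
      by (simp only: at_within_interior[OF \<open>t \<in> interior I\<close>])
  qed

  have frame: "wedge ?e\<^sub>1 ?e\<^sub>2 = 1" by (rule unit[OF \<open>0 \<in> I\<close>])
  have adapted: "p = p\<^sub>0 + \<xi> p *\<^sub>R ?e\<^sub>1 + \<eta> p *\<^sub>R ?e\<^sub>2" for p
    using \<open>affine_adapted_coordinates p\<^sub>0 I c \<xi> \<eta>\<close> by (simp add: affine_adapted_coordinates_def)
  have \<xi>_eq: "\<xi> = (\<lambda>p. wedge (p - p\<^sub>0) ?e\<^sub>2)" and \<eta>_eq: "\<eta> = (\<lambda>p. wedge ?e\<^sub>1 (p - p\<^sub>0))"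
    using frame_coordinates[OF frame adapted] by auto
  have coords: "p = q" if "\<xi> p = \<xi> q" "\<eta> p = \<eta> q" for p q
    using adapted[of p] adapted[of q] that by simp

  define u where "u n t = wedge (deriv_on I n c t) ?e\<^sub>2" for n t
  define v where "v n t = wedge ?e\<^sub>1 (deriv_on I n c t)" for n t
  have u': "(u n has_real_derivative u (Suc n) t) (at t)"
    and v': "(v n has_real_derivative v (Suc n) t) (at t)" if "n < 3" "t \<in> ?K" for n t
    unfolding u_def v_def has_real_derivative_iff_has_vector_derivative
    using bounded_linear.has_vector_derivative[OF
        bounded_bilinear.bounded_linear_left[OF bounded_bilinear_wedge] deriv[OF that]]
      bounded_linear.has_vector_derivative[OF
        bounded_bilinear.bounded_linear_right[OF bounded_bilinear_wedge] deriv[OF that]]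
    by auto
  have x_eq: "x = (\<lambda>t. u 0 t - wedge p\<^sub>0 ?e\<^sub>2)" and y_eq: "y = (\<lambda>t. v 0 t - wedge ?e\<^sub>1 p\<^sub>0)"
    by (auto simp: assms(9) assms(10) \<xi>_eq \<eta>_eq u_def v_def deriv_on_0 wedge_def algebra_simps)
  have x': "(x has_real_derivative u 1 t) (at t)" and y': "(y has_real_derivative v 1 t) (at t)"
    if "t \<in> ?K" for t
    unfolding x_eq y_eq using u'[of 0 t] v'[of 0 t] that
    by (auto intro!: derivative_eq_intros)
  have u1': "(u 1 has_real_derivative u 2 t) (at t)" and v1': "(v 1 has_real_derivative v 2 t) (at t)"
    if "t \<in> ?K" for t
    using u'[of 1 t] v'[of 1 t] that by (simp_all add: numeral_2_eq_2)
  have third: "deriv_on I 3 c t = - ?\<kappa> t *\<^sub>R deriv_on I 1 c t" if "t \<in> I" for t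
    by (rule affine_curvature(2)[OF speed nbot[OF that] that])
  have "u 3 t = - ?\<kappa> t * u 1 t" "v 3 t = - ?\<kappa> t * v 1 t" if "t \<in> ?K" for t
    unfolding u_def v_def third[OF subsetD[OF K_sub that]] wedge_simps by simp_all
  then have u2': "(u 2 has_real_derivative - ?\<kappa> t * u 1 t) (at t)"
    and v2': "(v 2 has_real_derivative - ?\<kappa> t * v 1 t) (at t)" if "t \<in> ?K" for t
    using u'[of 2 t] v'[of 2 t] that by (simp_all add: numeral_2_eq_2 numeral_3_eq_3)
  note jacobi_x = jacobi_on_both_sides[of L x "u 1" "u 2" ?\<kappa>, OF x' u1' u2']
  note jacobi_y = jacobi_on_both_sides[of L y "v 1" "v 2" ?\<kappa>, OF y' v1' v2']

  have init: "x 0 = 0" "u 1 0 = 1" "u 2 0 = 0" "y 0 = 0" "v 1 0 = 0" "v 2 0 = 1"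
    using frame by (simp_all add: u_def v_def x_eq y_eq deriv_on_0 c0)
  have \<kappa>_bounds: "k\<^sub>0 \<le> ?\<kappa> t \<and> ?\<kappa> t \<le> k\<^sub>1" if "t \<in> ?K" for t
    using assms(6) K_sub that by auto
  have bounds: "0 < u 1 s \<and> \<bar>x s\<bar> = (if 0 \<le> s then x s else - x s) \<and>
      xbar k\<^sub>1 \<bar>s\<bar> \<le> \<bar>x s\<bar> \<and> \<bar>x s\<bar> \<le> xbar k\<^sub>0 \<bar>s\<bar> \<and> ybar k\<^sub>1 s \<le> y s \<and> y s \<le> ybar k\<^sub>0 s"
    and equality: "\<And>t. xbar k\<^sub>1 \<bar>s\<bar> = \<bar>x s\<bar> \<or> ybar k\<^sub>1 s = y s \<Longrightarrow> t \<in> open_segment 0 s \<Longrightarrow> ?\<kappa> t = k\<^sub>1"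
      "\<And>t. \<bar>x s\<bar> = xbar k\<^sub>0 \<bar>s\<bar> \<or> y s = ybar k\<^sub>0 s \<Longrightarrow> t \<in> open_segment 0 s \<Longrightarrow> ?\<kappa> t = k\<^sub>0"
    if s: "s \<in> ?K" for s
  proof -
    \<comment> \<open>The double sign is what the curvature of the reflected curve at - t gives.\<close>
    have *: "?\<kappa> t = k" if "t \<in> open_segment 0 s"
      and "0 \<le> s \<Longrightarrow> 0 < t \<Longrightarrow> t < s \<Longrightarrow> ?\<kappa> t = k"
      and "s < 0 \<Longrightarrow> 0 < - t \<Longrightarrow> - t < - s \<Longrightarrow> ?\<kappa> (- (- t)) = k" for t k
      using that by (auto simp: open_segment_eq_real_ivl split: if_splits)
    have right_bounds: "\<forall>t\<in>{0..<L}. k\<^sub>0 \<le> ?\<kappa> t \<and> ?\<kappa> t \<le> k\<^sub>1"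
      and left_bounds: "\<forall>t\<in>{0..<L}. k\<^sub>0 \<le> ?\<kappa> (- t) \<and> ?\<kappa> (- t) \<le> k\<^sub>1"
      using \<kappa>_bounds by auto
    note right = model_bounds[OF jacobi_x(1) jacobi_y(1) init right_bounds L, of s]
    note left = model_bounds[OF jacobi_x(3) jacobi_y(2) _ _ _ _ _ _ left_bounds L, of "- s",
        unfolded minus_minus minus_zero init model_parity]
    \<comment> \<open>For negative s the reflected curve is evaluated at - s.\<close>
    show "0 < u 1 s \<and> \<bar>x s\<bar> = (if 0 \<le> s then x s else - x s) \<and>
      xbar k\<^sub>1 \<bar>s\<bar> \<le> \<bar>x s\<bar> \<and> \<bar>x s\<bar> \<le> xbar k\<^sub>0 \<bar>s\<bar> \<and> ybar k\<^sub>1 s \<le> y s \<and> y s \<le> ybar k\<^sub>0 s"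
    proof (cases "0 \<le> s")
      case True
      with s right(1-6) show ?thesis by simp
    next
      case False
      with s left(1-6) show ?thesis by simp
    qed
    then have abs: "\<bar>x s\<bar> = (if 0 \<le> s then x s else - x s)" by blast
    show "?\<kappa> t = k\<^sub>1" if "xbar k\<^sub>1 \<bar>s\<bar> = \<bar>x s\<bar> \<or> ybar k\<^sub>1 s = y s" "t \<in> open_segment 0 s" for t
      by (rule *[OF that(2)])
        (use s that(1) abs right(7)[where t = t] left(7)[where t = "- t"] in auto)
    show "?\<kappa> t = k\<^sub>0" if "\<bar>x s\<bar> = xbar k\<^sub>0 \<bar>s\<bar> \<or> y s = ybar k\<^sub>0 s" "t \<in> open_segment 0 s" for t
      by (rule *[OF that(2)])
        (use s that(1) abs right(8)[where t = t] left(8)[where t = "- t"] in auto)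
  qed

  have mono: "strict_mono_on ?K x"
  proof (rule strict_mono_onI)
    fix a b assume ab: "a \<in> ?K" "b \<in> ?K" "a < b"
    show "x a < x b"
    proof (rule DERIV_pos_imp_increasing[OF \<open>a < b\<close>])
      fix t assume "a \<le> t" "t \<le> b"
      with ab have "t \<in> ?K" by auto
      with x' bounds show "\<exists>m. (x has_real_derivative m) (at t) \<and> 0 < m" by blast
    qed
  qed
  have cont_deriv: "continuous_on I (deriv_on I n c)" if "n \<le> 3" for n
    using C3 that by (simp add: C_k_on_def)
  have cont_x: "continuous_on I x"
    unfolding x_eq u_def
    by (intro continuous_intros bounded_bilinear.continuous_on[OF bounded_bilinear_wedge] cont_deriv) simp
  have graphing: "?K \<subseteq> graphing_parameter_set I c \<xi> \<eta>"
  proof (rule subset_graphing_parameter_set[OF coords])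
    fix t assume t: "t \<in> I"
    have "deriv_on I 1 c t \<noteq> 0" using unit[OF t] by (auto simp: wedge_def)
    then show "\<exists>d>0. inj_on c (I \<inter> ball t d)"
      using has_vector_derivative_deriv_on[OF C3, of 0] cont_deriv[of 1] t
      by (intro regular_curve_locally_injective[OF I, where c' = "deriv_on I 1 c"])
        (auto simp: deriv_on_0)
  qed (use cont_x mono L K_sub in \<open>simp_all add: assms(9)\<close>)

  have interval: "{- xbar k\<^sub>1 L<..<xbar k\<^sub>1 L} \<subseteq> graphing_interval I c \<xi> \<eta>"
  proof
    fix r assume "r \<in> {- xbar k\<^sub>1 L<..<xbar k\<^sub>1 L}"
    then have "\<bar>r\<bar> < xbar k\<^sub>1 L" by auto
    \<comment> \<open>L itself need not be a parameter, so a slightly smaller one is used.\<close>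
    moreover have "(xbar k\<^sub>1 \<longlongrightarrow> xbar k\<^sub>1 L) (at_left L)"
      using DERIV_isCont[OF has_derivative_xbar] by (simp add: isCont_def filterlim_at_split)
    ultimately have "eventually (\<lambda>s. \<bar>r\<bar> < xbar k\<^sub>1 s) (at_left L)" by (rule order_tendstoD(1)[rotated])
    moreover have "eventually (\<lambda>s. 0 < s \<and> s < L) (at_left L)"
      using eventually_at_left_real[OF \<open>L > 0\<close>] by simp
    ultimately have "eventually (\<lambda>s. \<bar>r\<bar> < xbar k\<^sub>1 s \<and> 0 < s \<and> s < L) (at_left L)"
      by eventually_elim simp
    then obtain s where s: "\<bar>r\<bar> < xbar k\<^sub>1 s" "0 < s" "s < L"
      using eventually_happens'[OF trivial_limit_at_left_real] by blast
    have "x (- s) \<le> r" "r \<le> x s"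
      using bounds[of s] bounds[of "- s"] s by auto
    moreover have "continuous_on {-s..s} x"
      using s K_sub by (intro continuous_on_subset[OF cont_x]) auto
    ultimately obtain t where "- s \<le> t" "t \<le> s" "x t = r"
      using IVT'[of x "- s" r s] s by auto
    then have "r = \<xi> (c t)" "t \<in> ?K" using s by (auto simp: assms(9))
    then show "r \<in> graphing_interval I c \<xi> \<eta>"
      unfolding graphing_interval_def using graphing by blast
  qed

  have const_curv: "constant_affine_curvature (closed_segment 0 s) c k"
    if s: "s \<in> ?K" "s \<noteq> 0" and k: "\<And>t. t \<in> open_segment 0 s \<Longrightarrow> ?\<kappa> t = k" for s k
  proof (rule constant_affine_curvature_restrict[OF speed])
    let ?J = "closed_segment 0 s"
    have "?J \<subseteq> ?K" using s L by (auto simp: closed_segment_eq_real_ivl split: if_splits)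
    with K_sub show J: "?J \<subseteq> I" by blast
    show "at t within ?J \<noteq> bot" if "t \<in> ?J" for t
      by (rule interval_no_isolated_points[of _ 0 s])
        (use s that in \<open>auto simp: is_interval_convex_1\<close>)
    \<comment> \<open>The hypothesis on the curvature omits the endpoints; continuity supplies them.\<close>
    have "continuous_on ?J (\<lambda>t. wedge (deriv_on I 2 c t) (deriv_on I 3 c t))"
      using J by (intro bounded_bilinear.continuous_on[OF bounded_bilinear_wedge]
          continuous_on_subset[OF cont_deriv]) auto
    then have "continuous_on ?J ?\<kappa>"
      by (rule continuous_on_eq) (use J affine_curvature(1)[OF speed nbot] in auto)
    moreover have "closure (open_segment 0 s) = ?J" using s by (simp add: closure_open_segment)
    ultimately show "?\<kappa> t = k" if "t \<in> ?J" for t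
      using continuous_constant_on_closure[of "open_segment 0 s" ?\<kappa> k t] k that by simp
  qed

  show ?thesis
    unfolding Let_def
  proof (intro conjI ballI impI)
    fix s assume s: "s \<in> ?K" "s \<noteq> 0"
    show "constant_affine_curvature (closed_segment 0 s) c k\<^sub>1"
      if "xbar k\<^sub>1 \<bar>s\<bar> = \<bar>x s\<bar> \<or> ybar k\<^sub>1 s = y s"
      using const_curv[OF s] equality(1)[OF s(1) that] by blast
    show "constant_affine_curvature (closed_segment 0 s) c k\<^sub>0"
      if "\<bar>x s\<bar> = xbar k\<^sub>0 \<bar>s\<bar> \<or> y s = ybar k\<^sub>0 s"
      using const_curv[OF s] equality(2)[OF s(1) that] by blast
  qed (use graphing interval bounds in blast)+
qed

end
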